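(* Let $M$ be a metric space, let $X_1,X_2,\ldots$ be i.i.d. $M$-valued random variables, let $k\in\mathbb{N}_0$, and put $P_n=\{X_1,X_2,\ldots,X_n\}$. If the distribution of the $X_i$ has support equal to a compact subset $C\subset M$, then $$\beta_k(C)=\lim_{n\to\infty}\beta_k(P_n)\quad\text{almost surely},$$ the limit being taken in $\hat{\mathcal{B}}_\infty$ with respect to the bottleneck distance.
   Context: The support of a measure $\mu$ on a $\sigma$-algebra containing the Borel $\sigma$-algebra of $M$ is $\operatorname{supp}(\mu)=\{x\in M:\ \mu(B_\varepsilon(x))>0\ \text{for all }\varepsilon>0\}$, with $B_\varepsilon(x)$ the open ball. Homology has coefficients in a fixed field $\mathbf{k}$; reduced homology is $\tilde H_k(X)=\ker(H_k(X)\to H_k(\mathrm{pt}))$. Persistent homology: for a metric space $(M,d)$, a finite nonempty $P\subset M$ and $t\ge 0$, the Čech complex $\check C_t(P)$ is the abstract simplicial complex with vertex set $P$ in which $\{x_0,\dots,x_j\}$ spans a simplex iff $\bigcap_{i}\overline B_t(x_i)\neq\emptyset$, where $\overline B_t(x)=\{y\in M: d(x,y)\le t\}$. The persistence module $\mathrm{PH}_k(P)$ has $\mathrm{PH}_k(P)_t=\tilde H_k(\check C_t(P))$ for $t\ge 0$, with maps induced by inclusions. It is a direct sum of finitely many interval modules (an interval module is $\mathbf{k}$ on an interval and $0$ outside, with identity maps inside), all of finite length; the multiset of these intervals is the barcode of $\mathrm{PH}_k(P)$. Barcode space: $\mathcal{B}$ is the set of finite multisets of pairs $(x,d)\in\mathbb{R}_{\ge0}^2$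 (an interval with left endpoint $x$ and length $d$), where two multisets are identified if they agree after deleting pairs with $d=0$. $\beta_k(P)\in\mathcal{B}$ is the multiset of pairs (left endpoint, length) of the intervals in the barcode of $\mathrm{PH}_k(P)$. Bottleneck distance: put $d_\infty((x_1,d_1),(x_2,d_2))=\max(|x_1-x_2|,|(x_1+d_1)-(x_2+d_2)|)$ and $d_\infty((x,d),\Delta)=d/2$. For $b_1=\{I_i\}_{i=1}^n$, $b_2=\{J_j\}_{j=1}^m$, $d_\infty(b_1,b_2)$ is the minimum over all bijections $\theta:A\to B$ with $A\subset\{1,\dots,n\}$, $B\subset\{1,\dots,m\}$ of $\max\big(\max_{a\in A}d_\infty(I_a,J_{\theta(a)}),\max_{a\notin A}d_\infty(I_a,\Delta),\max_{b\notin B}d_\infty(J_b,\Delta)\big)$. $\hat{\mathcal{B}}_\infty$ is the completion of $(\mathcal{B},d_\infty)$. Barcodes of compact sets: let $K(M)$ be the set of nonempty compact subsets of $M$ with the Hausdorff distance $d_H(A,B)=\max(\inf\{t\ge0: A\subset B_t\},\inf\{t\ge0:B\subset A_t\})$, where $A_t=\{x\in M: d(x,A)\le t\}$. The map $\beta_k$ on finite nonempty subsets is $1$-Lipschitz from $d_H$ to $d_\infty$, and $\beta_k:K(M)\to\hat{\mathcal{B}}_\infty$ denotes its unique continuous extension (also $1$-Lipschitz).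
   Formalization: The formal theorem also assumes that the X_i almost surely lie in the closure of a countable set (automatic for separable M); otherwise, if real-valued measurable cardinals exist, the distribution may not be concentrated on its support and the claim fails. *)

theory Defs
  imports "HOL-Probability.Probability" "HOL-Library.Poly_Mapping"
begin

section \<open>Simplicial homology with coefficients in a field\<close>

text \<open>
  An abstract simplicial complex is given by its set of (nonempty, finite) simplices.
  Homology is that of the ordered chain complex: the chain group in degree \<open>k\<close> is the free
  vector space on all tuples \<open>[x\<^sub>0, \<dots>, x\<^sub>k]\<close>, repetitions allowed, whose entries span a simplex.
  No choice of orientations is needed, simplicial maps act on tuples entrywise, and the homology
  is naturally isomorphic to that of the oriented chain complex.
\<close>

definition chain_group :: "'a set set \<Rightarrow> nat \<Rightarrow> ('a list \<Rightarrow>\<^sub>0 'k::field) set" where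
  "chain_group K k = {c. \<forall>xs \<in> Poly_Mapping.keys c. length xs = k + 1 \<and> set xs \<in> K}"

definition chain_scale :: "'k::field \<Rightarrow> ('a list \<Rightarrow>\<^sub>0 'k) \<Rightarrow> ('a list \<Rightarrow>\<^sub>0 'k)" where
  "chain_scale r c = Poly_Mapping.map ((*) r) c"

definition boundary :: "('a list \<Rightarrow>\<^sub>0 'k::field) \<Rightarrow> ('a list \<Rightarrow>\<^sub>0 'k)" where
  "boundary c = (\<Sum>xs \<in> Poly_Mapping.keys c. \<Sum>i < length xs.
      Poly_Mapping.single (take i xs @ drop (Suc i) xs) ((-1) ^ i * Poly_Mapping.lookup c xs))"

text \<open>
  On chains of degree \<open>0\<close> the function \<open>boundary\<close> yields multiples of the empty tuple, i.e. it is
  the augmentation. In unreduced homology all chains of degree \<open>0\<close> are cycles, whence the case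
  \<open>k = 0\<close> below.
\<close>

definition cycles :: "'a set set \<Rightarrow> nat \<Rightarrow> ('a list \<Rightarrow>\<^sub>0 'k::field) set" where
  "cycles K k = {c \<in> chain_group K k. k = 0 \<or> boundary c = 0}"

definition boundaries :: "'a set set \<Rightarrow> nat \<Rightarrow> ('a list \<Rightarrow>\<^sub>0 'k::field) set" where
  "boundaries K k = boundary ` chain_group K (k + 1)"

text \<open>
  Homology classes are cosets \<open>z +o boundaries K k\<close>. Their sum is the sum of sets, and the zero
  class is \<open>boundaries K k\<close>. In \<open>homology_scale\<close> and \<open>homology_map\<close> the boundaries are added
  because the image of a coset need not be a full coset.
\<close>

definition homology :: "'a set set \<Rightarrow> nat \<Rightarrow> ('a list \<Rightarrow>\<^sub>0 'k::field) set set" where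
  "homology K k = (\<lambda>z. z +o boundaries K k) ` cycles K k"

definition homology_scale ::
    "'a set set \<Rightarrow> nat \<Rightarrow> 'k::field \<Rightarrow> ('a list \<Rightarrow>\<^sub>0 'k) set \<Rightarrow> ('a list \<Rightarrow>\<^sub>0 'k) set" where
  "homology_scale K k r h = chain_scale r ` h + boundaries K k"

definition chain_map :: "('a \<Rightarrow> 'b) \<Rightarrow> ('a list \<Rightarrow>\<^sub>0 'k::field) \<Rightarrow> ('b list \<Rightarrow>\<^sub>0 'k)" where
  "chain_map f c =
     (\<Sum>xs \<in> Poly_Mapping.keys c. Poly_Mapping.single (map f xs) (Poly_Mapping.lookup c xs))"

text \<open>The map into the homology of \<open>L\<close> induced by a simplicial map \<open>f\<close> into \<open>L\<close>:\<close>

definition homology_map ::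
    "('a \<Rightarrow> 'b) \<Rightarrow> 'b set set \<Rightarrow> nat \<Rightarrow> ('a list \<Rightarrow>\<^sub>0 'k::field) set \<Rightarrow> ('b list \<Rightarrow>\<^sub>0 'k) set" where
  "homology_map f L k h = chain_map f ` h + boundaries L k"

definition point_complex :: "unit set set" where
  "point_complex = {{()}}"

definition reduced_homology :: "'a set set \<Rightarrow> nat \<Rightarrow> ('a list \<Rightarrow>\<^sub>0 'k::field) set set" where
  "reduced_homology K k =
     {h \<in> homology K k. homology_map (\<lambda>_. ()) point_complex k h = boundaries point_complex k}"


section \<open>Persistence modules indexed by the nonnegative reals\<close>

text \<open>Only the values at parameters \<open>0 \<le> s \<le> t\<close> and on elements of the carriers are relevant.\<close>

record ('k, 'v) pmodule =
  pspace :: "real \<Rightarrow> 'v set"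
  padd :: "real \<Rightarrow> 'v \<Rightarrow> 'v \<Rightarrow> 'v"
  pscale :: "real \<Rightarrow> 'k \<Rightarrow> 'v \<Rightarrow> 'v"
  pmap :: "real \<Rightarrow> real \<Rightarrow> 'v \<Rightarrow> 'v"

definition pmodule_iso :: "('k, 'v) pmodule \<Rightarrow> ('k, 'w) pmodule \<Rightarrow> bool" where
  "pmodule_iso V W \<longleftrightarrow> (\<exists>\<phi>.
     (\<forall>t\<ge>0. bij_betw (\<phi> t) (pspace V t) (pspace W t) \<and>
        (\<forall>x\<in>pspace V t. \<forall>y\<in>pspace V t. \<phi> t (padd V t x y) = padd W t (\<phi> t x) (\<phi> t y)) \<and>
        (\<forall>r. \<forall>x\<in>pspace V t. \<phi> t (pscale V t r x) = pscale W t r (\<phi> t x))) \<and>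
     (\<forall>s\<ge>0. \<forall>t\<ge>s. \<forall>x\<in>pspace V s. \<phi> t (pmap V s t x) = pmap W s t (\<phi> s x)))"

definition interval_module :: "real set \<Rightarrow> ('k::field, 'k) pmodule" where
  "interval_module I =
     \<lparr> pspace = (\<lambda>t. if t \<in> I then UNIV else {0}),
       padd = (\<lambda>_. (+)),
       pscale = (\<lambda>_. (*)),
       pmap = (\<lambda>s t x. if s \<in> I \<and> t \<in> I then x else 0) \<rparr>"

text \<open>Direct sum over a finite index set:\<close>

definition direct_sum :: "'i set \<Rightarrow> ('i \<Rightarrow> ('k, 'v) pmodule) \<Rightarrow> ('k, 'i \<Rightarrow> 'v) pmodule" where
  "direct_sum S V =
     \<lparr> pspace = (\<lambda>t. \<Pi>\<^sub>E i\<in>S. pspace (V i) t),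
       padd = (\<lambda>t x y. \<lambda>i\<in>S. padd (V i) t (x i) (y i)),
       pscale = (\<lambda>t r x. \<lambda>i\<in>S. pscale (V i) t r (x i)),
       pmap = (\<lambda>s t x. \<lambda>i\<in>S. pmap (V i) s t (x i)) \<rparr>"

definition is_interval_decomposition ::
    "('k::field, 'v) pmodule \<Rightarrow> real set multiset \<Rightarrow> bool" where
  "is_interval_decomposition V b \<longleftrightarrow> (\<exists>Is. mset Is = b \<and>
     (\<forall>I\<in>set Is. is_interval I \<and> I \<noteq> {} \<and> I \<subseteq> {0..}) \<and>
     pmodule_iso V (direct_sum {..<length Is} (\<lambda>i. interval_module (Is ! i))))"

text \<open>Well defined by the theorem of Krull, Remak, Schmidt and Azumaya:\<close>

definition interval_multiset :: "('k::field, 'v) pmodule \<Rightarrow> real set multiset" where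
  "interval_multiset V = (THE b. is_interval_decomposition V b)"

definition cech_complex :: "real \<Rightarrow> 'a::metric_space set \<Rightarrow> 'a set set" where
  "cech_complex t P = {\<sigma>. \<sigma> \<subseteq> P \<and> finite \<sigma> \<and> \<sigma> \<noteq> {} \<and> (\<Inter>x\<in>\<sigma>. cball x t) \<noteq> {}}"

definition persistent_homology ::
    "nat \<Rightarrow> 'a::metric_space set \<Rightarrow> ('k::field, ('a list \<Rightarrow>\<^sub>0 'k) set) pmodule" where
  "persistent_homology k P =
     \<lparr> pspace = (\<lambda>t. reduced_homology (cech_complex t P) k),
       padd = (\<lambda>_. (+)),
       pscale = (\<lambda>t. homology_scale (cech_complex t P) k),
       pmap = (\<lambda>s t. homology_map (\<lambda>x. x) (cech_complex t P) k) \<rparr>"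


section \<open>The space of barcodes with the bottleneck distance\<close>

text \<open>A pair \<open>(x, d)\<close> stands for an interval with left endpoint \<open>x\<close> and length \<open>d\<close>.\<close>

definition interval_dist :: "real \<times> real \<Rightarrow> real \<times> real \<Rightarrow> real" where
  "interval_dist I J =
     max \<bar>fst I - fst J\<bar> \<bar>(fst I + snd I) - (fst J + snd J)\<bar>"

definition diag_dist :: "real \<times> real \<Rightarrow> real" where
  "diag_dist I = snd I / 2"

definition matching_cost ::
    "(real \<times> real) list \<Rightarrow> (real \<times> real) list \<Rightarrow> nat set \<Rightarrow> (nat \<Rightarrow> nat) \<Rightarrow> real" where
  "matching_cost xs ys A \<theta> = Max (insert 0
     ((\<lambda>a. interval_dist (xs ! a) (ys ! \<theta> a)) ` A \<union>
      (\<lambda>a. diag_dist (xs ! a)) ` ({..<length xs} - A) \<union>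
      (\<lambda>b. diag_dist (ys ! b)) ` ({..<length ys} - \<theta> ` A)))"

text \<open>
  The minimum also runs over the enumerations \<open>xs\<close>, \<open>ys\<close> of the two multisets, which has no
  effect on its value; the \<open>0\<close> inserted in \<open>matching_cost\<close> only matters for two empty multisets.
\<close>

definition matching_costs :: "(real \<times> real) multiset \<Rightarrow> (real \<times> real) multiset \<Rightarrow> real set" where
  "matching_costs b1 b2 = {matching_cost xs ys A \<theta> | xs ys A \<theta>.
     mset xs = b1 \<and> mset ys = b2 \<and>
     A \<subseteq> {..<length xs} \<and> \<theta> ` A \<subseteq> {..<length ys} \<and> inj_on \<theta> A}"

definition bottleneck_dist :: "(real \<times> real) multiset \<Rightarrow> (real \<times> real) multiset \<Rightarrow> real" where
  "bottleneck_dist b1 b2 = Min (matching_costs b1 b2)"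

definition barcode_mset :: "(real \<times> real) multiset \<Rightarrow> bool" where
  "barcode_mset b \<longleftrightarrow> (\<forall>I \<in># b. 0 \<le> fst I \<and> 0 \<le> snd I)"

definition barcode_eq :: "(real \<times> real) multiset \<Rightarrow> (real \<times> real) multiset \<Rightarrow> bool" where
  "barcode_eq b1 b2 \<longleftrightarrow> barcode_mset b1 \<and> barcode_mset b2 \<and>
     filter_mset (\<lambda>I. snd I \<noteq> 0) b1 = filter_mset (\<lambda>I. snd I \<noteq> 0) b2"

quotient_type barcode = "(real \<times> real) multiset" / partial: barcode_eq
proof (rule part_equivpI)
  show "\<exists>b. barcode_eq b b"
    by (rule exI[of _ "{#}"]) (simp add: barcode_eq_def barcode_mset_def)
  show "symp barcode_eq"
    by (rule sympI) (simp add: barcode_eq_def)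
  show "transp barcode_eq"
    by (rule transpI) (simp add: barcode_eq_def)
qed

definition bclose :: "real \<Rightarrow> (real \<times> real) multiset \<Rightarrow> (real \<times> real) multiset \<Rightarrow> bool" where
  "bclose r b1 b2 \<longleftrightarrow> (\<exists>c1 u c2 w. b1 = c1 + u \<and> b2 = c2 + w \<and>
     rel_mset (\<lambda>I J. interval_dist I J \<le> r) c1 c2 \<and>
     (\<forall>I\<in>#u. diag_dist I \<le> r) \<and> (\<forall>I\<in>#w. diag_dist I \<le> r))"

lemma interval_dist_commute: "interval_dist I J = interval_dist J I"
  unfolding interval_dist_def by (simp only: abs_minus_commute)

lemma interval_dist_triangle: "interval_dist I L \<le> interval_dist I J + interval_dist J L"
  unfolding interval_dist_def by linarith

lemma diag_dist_le: "diag_dist I \<le> interval_dist I J + diag_dist J"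
  unfolding interval_dist_def diag_dist_def by linarith

lemma matching_cost_le_iff:
  assumes "A \<subseteq> {..<length xs}"
  shows "matching_cost xs ys A \<theta> \<le> r \<longleftrightarrow> 0 \<le> r \<and>
     (\<forall>a\<in>A. interval_dist (xs ! a) (ys ! \<theta> a) \<le> r) \<and>
     (\<forall>a\<in>{..<length xs} - A. diag_dist (xs ! a) \<le> r) \<and>
     (\<forall>b\<in>{..<length ys} - \<theta> ` A. diag_dist (ys ! b) \<le> r)"
proof -
  have "finite A" using assms finite_subset by blast
  then show ?thesis unfolding matching_cost_def by (subst Max_le_iff) auto
qed

lemma mset_nth_split:
  assumes "A \<subseteq> {..<length xs}"
  shows "mset xs = image_mset ((!) xs) (mset_set A) + image_mset ((!) xs) (mset_set ({..<length xs} - A))"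
proof -
  have fA: "finite A" using assms finite_subset by blast
  have "mset xs = mset (map ((!) xs) [0..<length xs])" by (simp add: map_nth)
  also have "\<dots> = image_mset ((!) xs) (mset_set {..<length xs})"
    by (metis mset_map mset_set_upto_eq_mset_upto)
  also have "{..<length xs} = A \<union> ({..<length xs} - A)" using assms by auto
  also have "mset_set (A \<union> ({..<length xs} - A)) = mset_set A + mset_set ({..<length xs} - A)"
    by (rule mset_set_Union) (use fA in auto)
  finally show ?thesis by (metis image_mset_union)
qed

lemma matching_cost_imp_bclose:
  assumes A: "A \<subseteq> {..<length xs}" and th: "\<theta> ` A \<subseteq> {..<length ys}" and inj: "inj_on \<theta> A"
    and cost: "matching_cost xs ys A \<theta> \<le> r"
  shows "bclose r (mset xs) (mset ys)"
proof -
  have fA: "finite A" using A finite_subset by blast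
  note c = cost[unfolded matching_cost_le_iff[OF A]]
  have im: "image_mset ((!) ys) (mset_set (\<theta> ` A)) = image_mset (\<lambda>a. ys ! \<theta> a) (mset_set A)"
    by (simp add: image_mset_mset_set[OF inj, symmetric] multiset.map_comp comp_def)
  have rel: "rel_mset (\<lambda>I J. interval_dist I J \<le> r) (image_mset ((!) xs) (mset_set A))
     (image_mset ((!) ys) (mset_set (\<theta> ` A)))"
    unfolding im multiset.rel_map by (rule multiset.rel_refl_strong) (use c fA in auto)
  show ?thesis
    unfolding bclose_def
    apply (rule exI[of _ "image_mset ((!) xs) (mset_set A)"])
    apply (rule exI[of _ "image_mset ((!) xs) (mset_set ({..<length xs} - A))"])
    apply (rule exI[of _ "image_mset ((!) ys) (mset_set (\<theta> ` A))"])
    apply (rule exI[of _ "image_mset ((!) ys) (mset_set ({..<length ys} - \<theta> ` A))"])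
    using rel c mset_nth_split[OF A] mset_nth_split[OF th] by auto
qed

lemma bclose_imp_matching_cost:
  assumes "bclose r b1 b2" and r: "0 \<le> r"
  shows "\<exists>m\<in>matching_costs b1 b2. m \<le> r"
proof -
  obtain c1 u c2 w where 1: "b1 = c1 + u" "b2 = c2 + w"
      "rel_mset (\<lambda>I J. interval_dist I J \<le> r) c1 c2"
      "\<forall>I\<in>#u. diag_dist I \<le> r" "\<forall>I\<in>#w. diag_dist I \<le> r"
    using assms(1) unfolding bclose_def by blast
  obtain xs ys where 2: "mset xs = c1" "mset ys = c2" "list_all2 (\<lambda>I J. interval_dist I J \<le> r) xs ys"
    using 1(3) unfolding rel_mset_def by blast
  obtain us ws where 3: "mset us = u" "mset ws = w" by (metis ex_mset)
  have len: "length xs = length ys" using 2 list_all2_lengthD by blast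
  let ?A = "{..<length xs}"
  have A: "?A \<subseteq> {..<length (xs @ us)}" by auto
  have "matching_cost (xs @ us) (ys @ ws) ?A (\<lambda>x. x) \<le> r"
    unfolding matching_cost_le_iff[OF A]
    using 1 2 3 r len by (auto simp: nth_append list_all2_conv_all_nth)
  moreover have "matching_cost (xs @ us) (ys @ ws) ?A (\<lambda>x. x) \<in> matching_costs b1 b2"
    unfolding matching_costs_def
    using 1 2 3 len
    by (intro CollectI exI[of _ "xs @ us"] exI[of _ "ys @ ws"] exI[of _ ?A] exI[of _ "\<lambda>x. x"]) auto
  ultimately show ?thesis by blast
qed

lemma finite_matching_costs: "finite (matching_costs b1 b2)"
proof -
  let ?V = "insert 0 ((\<lambda>(I, J). interval_dist I J) ` (set_mset b1 \<times> set_mset b2)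
     \<union> diag_dist ` set_mset b1 \<union> diag_dist ` set_mset b2)"
  have "matching_costs b1 b2 \<subseteq> ?V"
  proof
    fix m assume "m \<in> matching_costs b1 b2"
    then obtain xs ys A \<theta> where m: "m = matching_cost xs ys A \<theta>" "mset xs = b1" "mset ys = b2"
      "A \<subseteq> {..<length xs}" "\<theta> ` A \<subseteq> {..<length ys}" "inj_on \<theta> A"
      unfolding matching_costs_def by auto
    have fA: "finite A" using m finite_subset by blast
    let ?S = "insert 0
     ((\<lambda>a. interval_dist (xs ! a) (ys ! \<theta> a)) ` A \<union>
      (\<lambda>a. diag_dist (xs ! a)) ` ({..<length xs} - A) \<union>
      (\<lambda>b. diag_dist (ys ! b)) ` ({..<length ys} - \<theta> ` A))"
    have "m \<in> ?S" unfolding m matching_cost_def by (rule Max_in) (use fA in auto)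
    moreover have "xs ! a \<in># b1" if "a < length xs" for a using that m(2) by auto
    moreover have "ys ! a \<in># b2" if "a < length ys" for a using that m(3) by auto
    ultimately show "m \<in> ?V" using m(4,5) by (auto simp: image_iff subset_iff) blast
  qed
  then show ?thesis by (rule finite_subset) auto
qed

lemma matching_costs_nonempty: "matching_costs b1 b2 \<noteq> {}"
proof -
  obtain xs ys where "mset xs = b1" "mset ys = b2" by (metis ex_mset)
  then have "matching_cost xs ys {} id \<in> matching_costs b1 b2"
    unfolding matching_costs_def
    by (intro CollectI exI[of _ xs] exI[of _ ys] exI[of _ "{}"] exI[of _ id]) simp
  then show ?thesis by blast
qed

lemma bottleneck_dist_in: "bottleneck_dist b1 b2 \<in> matching_costs b1 b2"
  unfolding bottleneck_dist_def by (rule Min_in[OF finite_matching_costs matching_costs_nonempty])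

lemma bclose_bottleneck_dist: "bclose (bottleneck_dist b1 b2) b1 b2"
proof -
  obtain xs ys A \<theta> where m: "mset xs = b1" "mset ys = b2" "A \<subseteq> {..<length xs}"
    "\<theta> ` A \<subseteq> {..<length ys}" "inj_on \<theta> A" "bottleneck_dist b1 b2 = matching_cost xs ys A \<theta>"
    using bottleneck_dist_in[of b1 b2] unfolding matching_costs_def by blast
  show ?thesis
    using matching_cost_imp_bclose[OF m(3-5), of "bottleneck_dist b1 b2"] m(1,2,6) by simp
qed

lemma bottleneck_dist_nonneg: "0 \<le> bottleneck_dist b1 b2"
proof -
  obtain xs ys A \<theta> where "A \<subseteq> {..<length xs}" "bottleneck_dist b1 b2 = matching_cost xs ys A \<theta>"
    using bottleneck_dist_in[of b1 b2] unfolding matching_costs_def by blast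
  then show ?thesis using matching_cost_le_iff[of A xs ys \<theta> "bottleneck_dist b1 b2"] by simp
qed

lemma bottleneck_dist_le: "bclose r b1 b2 \<Longrightarrow> 0 \<le> r \<Longrightarrow> bottleneck_dist b1 b2 \<le> r"
proof -
  assume "bclose r b1 b2" "0 \<le> r"
  then obtain m where m: "m \<in> matching_costs b1 b2" "m \<le> r"
    using bclose_imp_matching_cost by blast
  from Min_le[OF finite_matching_costs m(1)] m(2) show ?thesis
    unfolding bottleneck_dist_def by linarith
qed

lemma rel_mset_interval_dist_flip:
  assumes "rel_mset (\<lambda>I J. interval_dist I J \<le> r) M N"
  shows "rel_mset (\<lambda>I J. interval_dist I J \<le> r) N M"
proof -
  have "(\<lambda>I J. interval_dist I J \<le> r)\<inverse>\<inverse> = (\<lambda>I J. interval_dist I J \<le> r)"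
    by (intro ext) (metis conversep_iff interval_dist_commute)
  then show ?thesis using assms multiset.rel_flip[of "\<lambda>I J. interval_dist I J \<le> r" N M] by metis
qed

lemma bclose_sym: "bclose r b1 b2 \<Longrightarrow> bclose r b2 b1"
  unfolding bclose_def using rel_mset_interval_dist_flip by blast

lemma rel_mset_plus_split:
  assumes "rel_mset R (p + q) N"
  shows "\<exists>N1 N2. N = N1 + N2 \<and> rel_mset R p N1 \<and> rel_mset R q N2"
  using assms
proof (induction p arbitrary: N)
  case empty
  then show ?case by (intro exI[of _ "{#}"] exI[of _ N]) (simp add: rel_mset_Zero)
next
  case (add x p)
  then obtain N' b where N: "N = add_mset b N'" "R x b" "rel_mset R (p + q) N'"
    using msed_rel_invL[of R x "p + q" N] by (metis union_mset_add_mset_left)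
  then obtain N1 N2 where "N' = N1 + N2" "rel_mset R p N1" "rel_mset R q N2" using add.IH by blast
  then have "N = add_mset b N1 + N2" "rel_mset R (add_mset x p) (add_mset b N1)" "rel_mset R q N2"
    using N rel_mset_Plus[of R x b p N1] by simp_all
  then show ?case by blast
qed

lemma rel_mset_ex_left:
  assumes "rel_mset R M N" "x \<in># M"
  shows "\<exists>y\<in>#N. R x y"
proof -
  obtain M' where "M = add_mset x M'" using assms(2) by (rule mset_add)
  then obtain N1 b where "N = add_mset b N1" "R x b"
    using msed_rel_invL[of R x M' N] assms(1) by blast
  then show ?thesis by auto
qed

lemma mset_refinement:
  fixes a b c d :: "'x multiset"
  assumes "a + b = c + d"
  shows "\<exists>p q r s. a = p + q \<and> b = r + s \<and> c = p + r \<and> d = q + s"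
proof -
  have "a = a \<inter># c + (a - c) \<and> b = (c - a) + (b - (c - a)) \<and> c = a \<inter># c + (c - a) \<and>
    d = (a - c) + (b - (c - a))"
  proof (intro conjI multiset_eqI, goal_cases)
    case (1 x) show ?case by simp
  next
    case (2 x) show ?case using arg_cong[OF assms, of "\<lambda>m. count m x"] by simp
  next
    case (3 x) show ?case by simp
  next
    case (4 x) show ?case using arg_cong[OF assms, of "\<lambda>m. count m x"] by simp
  qed
  then show ?thesis by blast
qed

lemma bclose_trans:
  assumes "bclose r b1 b2" "bclose s b2 b3" "0 \<le> r" "0 \<le> s"
  shows "bclose (r + s) b1 b3"
proof -
  let ?R = "\<lambda>r I J. interval_dist I J \<le> r"
  obtain c1 u c2 w where 1: "b1 = c1 + u" "b2 = c2 + w" "rel_mset (?R r) c1 c2"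
      "\<forall>I\<in>#u. diag_dist I \<le> r" "\<forall>I\<in>#w. diag_dist I \<le> r"
    using assms(1) unfolding bclose_def by blast
  obtain c3 x c2' w' where 2: "b3 = c3 + x" "b2 = c2' + w'" "rel_mset (?R s) c3 c2'"
      "\<forall>I\<in>#x. diag_dist I \<le> s" "\<forall>I\<in>#w'. diag_dist I \<le> s"
    using bclose_sym[OF assms(2)] unfolding bclose_def by blast
  have "c2 + w = c2' + w'" using 1 2 by simp
  then obtain p q v z where 3: "c2 = p + q" "w = v + z" "c2' = p + v" "w' = q + z"
    using mset_refinement by blast
  note flip = rel_mset_interval_dist_flip
  obtain p1 q1 where 4: "c1 = p1 + q1" "rel_mset (?R r) p p1" "rel_mset (?R r) q q1"
    using rel_mset_plus_split[of "?R r" p q c1] flip[OF 1(3)] 3 by auto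
  obtain p3 v3 where 5: "c3 = p3 + v3" "rel_mset (?R s) p p3" "rel_mset (?R s) v v3"
    using rel_mset_plus_split[of "?R s" p v c3] flip[OF 2(3)] 3 by auto
  have "rel_mset (?R r OO ?R s) p1 p3"
    unfolding multiset.rel_compp using flip[OF 4(2)] 5(2) by blast
  moreover have "(?R r OO ?R s) \<le> ?R (r + s)"
  proof (intro predicate2I, elim relcomppE)
    fix I J L assume "interval_dist I J \<le> r" "interval_dist J L \<le> s"
    then show "interval_dist I L \<le> r + s" using interval_dist_triangle[of I L J] by linarith
  qed
  ultimately have rel: "rel_mset (?R (r + s)) p1 p3"
    using multiset.rel_mono by blast
  have "diag_dist I \<le> r + s" if I: "I \<in># q1" for I
  proof -
    obtain J where J: "J \<in># q" "interval_dist I J \<le> r"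
      using rel_mset_ex_left[OF flip[OF 4(3)] I] by blast
    then have "diag_dist J \<le> s" using 2 3 by auto
    with J diag_dist_le[of I J] show ?thesis by linarith
  qed
  moreover have "diag_dist I \<le> r + s" if I: "I \<in># v3" for I
  proof -
    obtain J where J: "J \<in># v" "interval_dist I J \<le> s"
      using rel_mset_ex_left[OF flip[OF 5(3)] I] by blast
    then have "diag_dist J \<le> r" using 1 3 by auto
    with J diag_dist_le[of I J] show ?thesis by linarith
  qed
  ultimately have "\<forall>I\<in>#q1 + u. diag_dist I \<le> r + s" "\<forall>I\<in>#v3 + x. diag_dist I \<le> r + s"
    using 1(4) 2(4) assms(3,4) by (auto intro: add_increasing add_increasing2)
  moreover have "b1 = p1 + (q1 + u)" "b3 = p3 + (v3 + x)"
    using 1(1) 2(1) 4(1) 5(1) by (simp_all add: add.assoc)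
  ultimately show ?thesis
    unfolding bclose_def using rel by blast
qed

lemma bottleneck_dist_commute: "bottleneck_dist b1 b2 = bottleneck_dist b2 b1"
  by (rule antisym) (rule bottleneck_dist_le[OF bclose_sym[OF bclose_bottleneck_dist] bottleneck_dist_nonneg])+

lemma bottleneck_dist_triangle:
  "bottleneck_dist b1 b3 \<le> bottleneck_dist b1 b2 + bottleneck_dist b2 b3"
  by (rule bottleneck_dist_le[OF bclose_trans[OF bclose_bottleneck_dist bclose_bottleneck_dist
        bottleneck_dist_nonneg bottleneck_dist_nonneg]
      add_nonneg_nonneg[OF bottleneck_dist_nonneg bottleneck_dist_nonneg]])

lemma bottleneck_dist_eq_0_iff:
  assumes "barcode_mset b1" "barcode_mset b2"
  shows "bottleneck_dist b1 b2 = 0 \<longleftrightarrow> barcode_eq b1 b2"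
proof
  assume "bottleneck_dist b1 b2 = 0"
  then have "bclose 0 b1 b2" using bclose_bottleneck_dist[of b1 b2] by simp
  then obtain c1 u c2 w where 1: "b1 = c1 + u" "b2 = c2 + w"
      "rel_mset (\<lambda>I J. interval_dist I J \<le> 0) c1 c2"
      "\<forall>I\<in>#u. diag_dist I \<le> 0" "\<forall>I\<in>#w. diag_dist I \<le> 0"
    unfolding bclose_def by blast
  have "(\<lambda>I J. interval_dist I J \<le> 0) = (=)"
    by (auto simp: fun_eq_iff interval_dist_def max_def split: if_splits)
  then have "c1 = c2" using 1(3) by (simp add: multiset.rel_eq)
  moreover have "\<forall>I\<in>#u. snd I = 0" "\<forall>I\<in>#w. snd I = 0"
    using 1 assms by (auto simp: barcode_mset_def diag_dist_def intro!: antisym)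
  moreover from this have "filter_mset (\<lambda>I. snd I \<noteq> 0) u = {#}" "filter_mset (\<lambda>I. snd I \<noteq> 0) w = {#}"
    by simp_all
  ultimately show "barcode_eq b1 b2"
    using assms unfolding barcode_eq_def 1(1,2) filter_union_mset by metis
next
  assume eq: "barcode_eq b1 b2"
  let ?f = "filter_mset (\<lambda>I. snd I \<noteq> (0::real))" and ?g = "filter_mset (\<lambda>I. \<not> snd I \<noteq> (0::real))"
  have f: "?f b1 = ?f b2" using eq by (simp add: barcode_eq_def)
  have "rel_mset (\<lambda>I J. interval_dist I J \<le> 0) (?f b1) (?f b2)"
    unfolding f by (rule multiset.rel_refl) (simp add: interval_dist_def)
  moreover have "\<forall>I\<in>#?g b1. diag_dist I \<le> 0" "\<forall>I\<in>#?g b2. diag_dist I \<le> 0"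
    by (simp_all add: diag_dist_def)
  moreover have "b1 = ?f b1 + ?g b1" "b2 = ?f b2 + ?g b2"
    by (rule multiset_partition)+
  ultimately have "bclose 0 b1 b2"
    unfolding bclose_def by blast
  then have "bottleneck_dist b1 b2 \<le> 0" by (rule bottleneck_dist_le) simp
  then show "bottleneck_dist b1 b2 = 0" using bottleneck_dist_nonneg[of b1 b2] by linarith
qed

lemma bottleneck_dist_cong:
  assumes "barcode_eq a a'" "barcode_eq b b'"
  shows "bottleneck_dist a b = bottleneck_dist a' b'"
proof -
  have "bottleneck_dist a a' = 0" "bottleneck_dist b b' = 0"
    using assms bottleneck_dist_eq_0_iff[of a a'] bottleneck_dist_eq_0_iff[of b b']
    unfolding barcode_eq_def by blast+
  moreover have "bottleneck_dist a b \<le> bottleneck_dist a a' + bottleneck_dist a' b"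
      "bottleneck_dist a' b \<le> bottleneck_dist a' b' + bottleneck_dist b' b"
      "bottleneck_dist a' b' \<le> bottleneck_dist a' a + bottleneck_dist a b'"
      "bottleneck_dist a b' \<le> bottleneck_dist a b + bottleneck_dist b b'"
    by (rule bottleneck_dist_triangle)+
  moreover have "bottleneck_dist a' a = bottleneck_dist a a'" "bottleneck_dist b' b = bottleneck_dist b b'"
    by (rule bottleneck_dist_commute)+
  ultimately show ?thesis by linarith
qed

instantiation barcode :: metric_space
begin

lift_definition dist_barcode :: "barcode \<Rightarrow> barcode \<Rightarrow> real" is bottleneck_dist
  by (rule bottleneck_dist_cong)

definition uniformity_barcode :: "(barcode \<times> barcode) filter" where
  "uniformity_barcode = (INF e\<in>{0<..}. principal {(x, y). dist x y < e})"

definition open_barcode :: "barcode set \<Rightarrow> bool" where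
  "open_barcode U \<longleftrightarrow> (\<forall>x\<in>U. \<forall>\<^sub>F (x', y) in uniformity. x' = x \<longrightarrow> y \<in> U)"

instance
proof
  fix x y z :: barcode
  show "dist x y = 0 \<longleftrightarrow> x = y"
  proof transfer
    fix x y assume "barcode_eq x x" "barcode_eq y y"
    then show "bottleneck_dist x y = 0 \<longleftrightarrow> barcode_eq x y"
      using bottleneck_dist_eq_0_iff[of x y] unfolding barcode_eq_def by blast
  qed
  show "dist x y \<le> dist x z + dist y z"
  proof transfer
    fix x y z
    show "bottleneck_dist x y \<le> bottleneck_dist x z + bottleneck_dist y z"
      using bottleneck_dist_triangle[of x y z] bottleneck_dist_commute[of y z] by linarith
  qed
qed (simp_all add: uniformity_barcode_def open_barcode_def)

end


section \<open>The completion of a metric space\<close>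

definition cauchy_equiv :: "(nat \<Rightarrow> 'a::metric_space) \<Rightarrow> (nat \<Rightarrow> 'a) \<Rightarrow> bool" where
  "cauchy_equiv u v \<longleftrightarrow> Cauchy u \<and> Cauchy v \<and> (\<lambda>n. dist (u n) (v n)) \<longlonglongrightarrow> 0"

lemma cauchy_equiv_const [simp]: "cauchy_equiv (\<lambda>_. x) (\<lambda>_. x)"
  by (simp add: cauchy_equiv_def LIMSEQ_imp_Cauchy[OF tendsto_const])

quotient_type (overloaded) 'a completion = "nat \<Rightarrow> 'a::metric_space" / partial: cauchy_equiv
proof (rule part_equivpI)
  show "\<exists>u :: nat \<Rightarrow> 'a. cauchy_equiv u u"
    using cauchy_equiv_const by blast
  show "symp (cauchy_equiv :: (nat \<Rightarrow> 'a) \<Rightarrow> _)"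
    by (auto simp: cauchy_equiv_def dist_commute intro!: sympI)
  show "transp (cauchy_equiv :: (nat \<Rightarrow> 'a) \<Rightarrow> _)"
  proof (rule transpI)
    fix u v w :: "nat \<Rightarrow> 'a"
    assume uv: "cauchy_equiv u v" and vw: "cauchy_equiv v w"
    have "(\<lambda>n. dist (u n) (v n) + dist (v n) (w n)) \<longlonglongrightarrow> 0"
      using tendsto_add[of "\<lambda>n. dist (u n) (v n)" 0 _ "\<lambda>n. dist (v n) (w n)" 0] uv vw
      by (auto simp: cauchy_equiv_def)
    then have "(\<lambda>n. dist (u n) (w n)) \<longlonglongrightarrow> 0"
      by (rule Lim_null_comparison[rotated]) (simp add: dist_triangle always_eventually)
    then show "cauchy_equiv u w" using uv vw by (auto simp: cauchy_equiv_def)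
  qed
qed

lemma Cauchy_dist_convergent:
  assumes "Cauchy u" "Cauchy v"
  shows "convergent (\<lambda>n. dist (u n) (v n))"
proof -
  have "Cauchy (\<lambda>n. dist (u n) (v n))"
  proof (rule metric_CauchyI)
    fix e :: real assume "0 < e"
    then obtain M N where M: "\<forall>m\<ge>M. \<forall>n\<ge>M. dist (u m) (u n) < e / 2"
      and N: "\<forall>m\<ge>N. \<forall>n\<ge>N. dist (v m) (v n) < e / 2"
      using assms metric_CauchyD[of _ "e / 2"] by (meson half_gt_zero)
    have "dist (dist (u m) (v m)) (dist (u n) (v n)) < e" if "m \<ge> max M N" "n \<ge> max M N" for m n
    proof -
      have "dist (u m) (u n) < e / 2" "dist (v m) (v n) < e / 2" using M N that by auto
      then show ?thesis
        unfolding dist_real_def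
        using dist_triangle[of "u m" "v m" "u n"] dist_triangle[of "u n" "v m" "v n"]
          dist_triangle[of "u n" "v n" "u m"] dist_triangle[of "u m" "v n" "v m"]
        by (simp add: dist_commute abs_if)
    qed
    then show "\<exists>M. \<forall>m\<ge>M. \<forall>n\<ge>M. dist (dist (u m) (v m)) (dist (u n) (v n)) < e" by blast
  qed
  then show ?thesis by (simp add: Cauchy_convergent_iff)
qed

lemma lim_dist_cong:
  assumes "cauchy_equiv u u'" "cauchy_equiv v v'"
  shows "lim (\<lambda>n. dist (u n) (v n)) = lim (\<lambda>n. dist (u' n) (v' n))"
proof -
  have c: "(\<lambda>n. dist (u n) (v n)) \<longlonglongrightarrow> lim (\<lambda>n. dist (u n) (v n))"
    using assms Cauchy_dist_convergent[of u v] unfolding cauchy_equiv_def convergent_LIMSEQ_iff by blast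
  have "(\<lambda>n. dist (u n) (u' n) + dist (v n) (v' n)) \<longlonglongrightarrow> 0"
    using tendsto_add[of "\<lambda>n. dist (u n) (u' n)" 0 _ "\<lambda>n. dist (v n) (v' n)" 0] assms
    by (auto simp: cauchy_equiv_def)
  moreover have "\<bar>dist (u' n) (v' n) - dist (u n) (v n)\<bar> \<le> dist (u n) (u' n) + dist (v n) (v' n)" for n
    using dist_triangle[of "u n" "v n" "u' n"] dist_triangle[of "u' n" "v n" "v' n"]
      dist_triangle[of "u' n" "v' n" "u n"] dist_triangle[of "u n" "v' n" "v n"]
    by (simp add: dist_commute abs_if)
  ultimately have "(\<lambda>n. dist (u' n) (v' n) - dist (u n) (v n)) \<longlonglongrightarrow> 0"
    by (intro Lim_null_comparison[of "\<lambda>n. dist (u' n) (v' n) - dist (u n) (v n)"])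
       (auto intro: always_eventually)
  from tendsto_add[OF this c] show ?thesis by (simp add: limI)
qed

instantiation completion :: (metric_space) metric_space
begin

lift_definition dist_completion :: "'a completion \<Rightarrow> 'a completion \<Rightarrow> real" is
  "\<lambda>u v. lim (\<lambda>n. dist (u n) (v n))"
  by (rule lim_dist_cong)

definition uniformity_completion :: "('a completion \<times> 'a completion) filter" where
  "uniformity_completion = (INF e\<in>{0<..}. principal {(x, y). dist x y < e})"

definition open_completion :: "'a completion set \<Rightarrow> bool" where
  "open_completion U \<longleftrightarrow> (\<forall>x\<in>U. \<forall>\<^sub>F (x', y) in uniformity. x' = x \<longrightarrow> y \<in> U)"

instance
proof
  fix x y z :: "'a completion"
  have lim: "(\<lambda>n. dist (u n) (v n)) \<longlonglongrightarrow> lim (\<lambda>n. dist (u n) (v n))"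
    if "cauchy_equiv u u" "cauchy_equiv v v" for u v :: "nat \<Rightarrow> 'a"
    using that Cauchy_dist_convergent[of u v] unfolding cauchy_equiv_def convergent_LIMSEQ_iff by blast
  show "dist x y = 0 \<longleftrightarrow> x = y"
  proof transfer
    fix u v :: "nat \<Rightarrow> 'a" assume uv: "cauchy_equiv u u" "cauchy_equiv v v"
    show "lim (\<lambda>n. dist (u n) (v n)) = 0 \<longleftrightarrow> cauchy_equiv u v"
      using lim[OF uv] uv limI[of "\<lambda>n. dist (u n) (v n)" 0] unfolding cauchy_equiv_def by metis
  qed
  show "dist x y \<le> dist x z + dist y z"
  proof transfer
    fix u v w :: "nat \<Rightarrow> 'a"
    assume a: "cauchy_equiv u u" "cauchy_equiv v v" "cauchy_equiv w w"
    show "lim (\<lambda>n. dist (u n) (v n)) \<le> lim (\<lambda>n. dist (u n) (w n)) + lim (\<lambda>n. dist (v n) (w n))"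
      by (rule LIMSEQ_le[OF lim[OF a(1,2)] tendsto_add[OF lim[OF a(1,3)] lim[OF a(2,3)]]])
         (simp add: dist_triangle2)
  qed
qed (simp_all add: uniformity_completion_def open_completion_def)

end

lift_definition to_completion :: "'a::metric_space \<Rightarrow> 'a completion" is "\<lambda>x _. x"
  by simp

lemma dist_to_completion [simp]: "dist (to_completion x) (to_completion y) = dist x y"
  by transfer simp


lemma to_completion_tendsto:
  assumes "Cauchy u"
  shows "(\<lambda>n. to_completion (u n)) \<longlonglongrightarrow> abs_completion u"
proof -
  have uu: "cauchy_equiv u u" using assms by (simp add: cauchy_equiv_def)
  have d: "dist (to_completion (u n)) (abs_completion u) = lim (\<lambda>m. dist (u n) (u m))" for n
    unfolding to_completion.abs_eq
    by (rule dist_completion.abs_eq[OF cauchy_equiv_const uu])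
  show ?thesis
    unfolding lim_sequentially
  proof (intro allI impI)
    fix e :: real assume "0 < e"
    then obtain N where N: "\<forall>m\<ge>N. \<forall>n\<ge>N. dist (u m) (u n) < e / 2"
      using metric_CauchyD[OF assms, of "e / 2"] by auto
    have "dist (to_completion (u n)) (abs_completion u) < e" if n: "n \<ge> N" for n
    proof -
      have "(\<lambda>m. dist (u n) (u m)) \<longlonglongrightarrow> lim (\<lambda>m. dist (u n) (u m))"
        using Cauchy_dist_convergent[of "\<lambda>_. u n" u] assms LIMSEQ_imp_Cauchy[OF tendsto_const[of "u n"]]
        unfolding convergent_LIMSEQ_iff by blast
      moreover have "\<forall>m\<ge>N. dist (u n) (u m) \<le> e / 2"
        using N n by (auto intro: less_imp_le)
      ultimately have "lim (\<lambda>m. dist (u n) (u m)) \<le> e / 2"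
        using LIMSEQ_le_const2 by blast
      then show ?thesis using d[of n] \<open>0 < e\<close> by linarith
    qed
    then show "\<exists>N. \<forall>n\<ge>N. dist (to_completion (u n)) (abs_completion u) < e" by blast
  qed
qed

lemma to_completion_dense: "closure (range to_completion) = UNIV"
proof (intro equalityI subset_UNIV subsetI)
  fix x :: "'a completion"
  have "cauchy_equiv (rep_completion x) (rep_completion x)"
    using Quotient_rep_reflp[OF Quotient_completion] .
  then have "Cauchy (rep_completion x)" by (simp add: cauchy_equiv_def)
  then have "(\<lambda>n. to_completion (rep_completion x n)) \<longlonglongrightarrow> abs_completion (rep_completion x)"
    by (rule to_completion_tendsto)
  moreover have "abs_completion (rep_completion x) = x"
    using Quotient_abs_rep[OF Quotient_completion] .
  ultimately show "x \<in> closure (range to_completion)"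
    unfolding closure_sequential by (intro exI[of _ "\<lambda>n. to_completion (rep_completion x n)"]) simp
qed

instance completion :: (metric_space) complete_space
proof
  fix X :: "nat \<Rightarrow> 'a completion" assume X: "Cauchy X"
  have "\<exists>a. dist (to_completion a) (X n) < inverse (Suc n)" for n
  proof -
    have "X n \<in> closure (range to_completion)" by (simp add: to_completion_dense)
    moreover have "(0::real) < inverse (Suc n)" by simp
    ultimately show ?thesis unfolding closure_approachable by blast
  qed
  then obtain a where a: "\<And>n. dist (to_completion (a n)) (X n) < inverse (Suc n)" by metis
  have d0: "(\<lambda>n. dist (to_completion (a n)) (X n)) \<longlonglongrightarrow> 0"
  proof (rule Lim_null_comparison[OF always_eventually LIMSEQ_inverse_real_of_nat], rule allI)
    show "norm (dist (to_completion (a n)) (X n)) \<le> inverse (real (Suc n))" for n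
      using a[of n] by simp
  qed
  have "Cauchy a"
  proof (rule metric_CauchyI)
    fix e :: real assume "0 < e"
    then obtain M where M: "\<forall>m\<ge>M. \<forall>n\<ge>M. dist (X m) (X n) < e / 3"
      using metric_CauchyD[OF X, of "e / 3"] by auto
    obtain N where N: "\<forall>n\<ge>N. dist (to_completion (a n)) (X n) < e / 3"
      using d0 \<open>0 < e\<close> LIMSEQ_D[OF d0, of "e / 3"] by auto
    have "dist (a m) (a n) < e" if "m \<ge> max M N" "n \<ge> max M N" for m n
    proof -
      have "dist (to_completion (a m)) (X m) < e / 3" "dist (to_completion (a n)) (X n) < e / 3"
        "dist (X m) (X n) < e / 3" using M N that by auto
      then have "dist (to_completion (a m)) (to_completion (a n)) < e"
        using dist_triangle[of "to_completion (a m)" "to_completion (a n)" "X m"]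
          dist_triangle2[of "X m" "to_completion (a n)" "X n"] by linarith
      then show ?thesis by simp
    qed
    then show "\<exists>M. \<forall>m\<ge>M. \<forall>n\<ge>M. dist (a m) (a n) < e" by blast
  qed
  then have "(\<lambda>n. to_completion (a n)) \<longlonglongrightarrow> abs_completion a" by (rule to_completion_tendsto)
  then have "(\<lambda>n. dist (to_completion (a n)) (abs_completion a)) \<longlonglongrightarrow> 0"
    by (rule iffD1[OF tendsto_dist_iff])
  from tendsto_add[OF d0 this]
  have "(\<lambda>n. dist (to_completion (a n)) (X n) + dist (to_completion (a n)) (abs_completion a)) \<longlonglongrightarrow> 0"
    by simp
  then have "(\<lambda>n. dist (X n) (abs_completion a)) \<longlonglongrightarrow> 0"
    by (rule Lim_null_comparison[rotated]) (simp add: dist_triangle3 always_eventually)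
  then have "X \<longlonglongrightarrow> abs_completion a"
    by (rule iffD2[OF tendsto_dist_iff])
  then show "convergent X" by (rule convergentI)
qed


section \<open>Barcodes of compact sets\<close>

definition barcode_of :: "'k::field itself \<Rightarrow> nat \<Rightarrow> 'a::metric_space set \<Rightarrow> barcode" where
  "barcode_of _ k P = abs_barcode (image_mset (\<lambda>I. (Inf I, Sup I - Inf I))
     (interval_multiset (persistent_homology k P :: ('k, ('a list \<Rightarrow>\<^sub>0 'k) set) pmodule)))"

definition thickening :: "'a::metric_space set \<Rightarrow> real \<Rightarrow> 'a set" where
  "thickening A t = {x. infdist x A \<le> t}"

definition hausdorff_dist :: "'a::metric_space set \<Rightarrow> 'a set \<Rightarrow> real" where
  "hausdorff_dist A B =
     max (Inf {t. 0 \<le> t \<and> A \<subseteq> thickening B t}) (Inf {t. 0 \<le> t \<and> B \<subseteq> thickening A t})"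

definition nonempty_compacts :: "'a::metric_space set set" where
  "nonempty_compacts = {C. compact C \<and> C \<noteq> {}}"

text \<open>
  The map \<open>\<beta>\<close> is the continuous extension of \<open>barcode_of F k\<close> from the nonempty finite sets to the
  nonempty compact sets with the Hausdorff distance. It exists by the stability theorem (which
  says that \<open>barcode_of F k\<close> is 1-Lipschitz) and is unique on nonempty compact sets, since the
  finite ones are dense among them; its values on other sets are irrelevant.
\<close>

definition is_compact_barcode_map ::
    "'k::field itself \<Rightarrow> nat \<Rightarrow> ('a::metric_space set \<Rightarrow> barcode completion) \<Rightarrow> bool" where
  "is_compact_barcode_map F k \<beta> \<longleftrightarrow>
     (\<forall>P. finite P \<and> P \<noteq> {} \<longrightarrow> \<beta> P = to_completion (barcode_of F k P)) \<and>
     (\<forall>C\<in>nonempty_compacts. \<forall>e>0. \<exists>d>0. \<forall>D\<in>nonempty_compacts.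
        hausdorff_dist D C < d \<longrightarrow> dist (\<beta> D) (\<beta> C) < e)"


section \<open>The support of a measure\<close>

definition measure_support :: "'a::metric_space measure \<Rightarrow> 'a set" where
  "measure_support \<mu> = {x. \<forall>\<epsilon>>0. emeasure \<mu> (ball x \<epsilon>) > 0}"

end

theory Submission
  imports Defs
begin

text \<open>
  The map \<open>\<beta>\<close> is continuous at \<open>C\<close> for the Hausdorff distance and agrees with the finite barcodes
  on the samples, so the claim is the almost sure Hausdorff convergence of the samples
  \<open>P\<^sub>n = {X\<^sub>1, \<dots>, X\<^sub>n}\<close> to \<open>C\<close>
  (\<open>compact_barcode_map_tendsto\<close>).

  Both halves of the Hausdorff distance are controlled separately. The inclusion \<open>P\<^sub>n \<subseteq> C\<close> holds
  almost surely because the law \<open>\<mu>\<close> is concentrated on its support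
  (\<open>AE_in_measure_support\<close>); separability is what covers the complement of the support, up to
  a null set, by countably many null balls. For the other half, every ball centred at a point of the support has positive measure, so by independence it is almost
  surely hit by some \<open>X\<^sub>i\<close> (\<open>indep_vars_AE_hits\<close>). By compactness, for each scale
  \<open>1 / (m + 1)\<close> finitely many such balls cover \<open>C\<close>, so only countably many null sets have to be
  discarded, and once the sample has hit all balls of scale \<open>1 / (m + 1)\<close> it is
  \<open>2 / (m + 1)\<close>-dense in \<open>C\<close> (\<open>hausdorff_dist_le_of_net\<close>).
\<close>

section \<open>Concentration of a measure on its support\<close>

text \<open>
  Off the support every point has a null ball around it, hence lies in a null ball with centre in
  \<open>Q\<close> and rational radius if it belongs to the closure of \<open>Q\<close>. There are only countably many
  balls of the latter kind.
\<close>

lemma AE_in_measure_support: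
  fixes \<mu> :: "'a::metric_space measure"
  assumes borel: "sets borel \<subseteq> sets \<mu>"
    and Q: "countable Q" "AE x in \<mu>. x \<in> closure Q"
  shows "AE x in \<mu>. x \<in> measure_support \<mu>"
proof -
  define N where "N = {(q, r). q \<in> Q \<and> r \<in> \<rat> \<and> emeasure \<mu> (ball q r) = 0}"
  have "countable (Q \<times> (\<rat> :: real set))"
    using Q(1) countable_rat by (rule countable_SIGMA)
  then have "countable N"
    by (rule countable_subset[rotated]) (auto simp: N_def)
  moreover have "AE x in \<mu>. x \<notin> ball (fst p) (snd p)" if "p \<in> N" for p
    using that borel by (intro AE_not_in null_setsI) (auto simp: N_def)
  ultimately have "AE x in \<mu>. \<forall>p\<in>N. x \<notin> ball (fst p) (snd p)"
    by (simp add: AE_ball_countable)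
  with Q(2) show ?thesis
  proof eventually_elim
    case (elim x)
    show ?case
    proof (rule ccontr)
      assume "x \<notin> measure_support \<mu>"
      then obtain e where e: "e > 0" "emeasure \<mu> (ball x e) = 0"
        by (auto simp: measure_support_def)
      obtain q where q: "q \<in> Q" "dist q x < e / 2"
        using elim(1) e(1) unfolding closure_approachable by (meson half_gt_zero)
      obtain r where r: "r \<in> \<rat>" "dist q x < r" "r < e / 2"
        using Rats_dense_in_real[OF q(2)] by blast
      have sub: "ball q r \<subseteq> ball x e"
      proof
        fix y assume "y \<in> ball q r"
        then show "y \<in> ball x e"
          using r q dist_triangle[of x y q] by (simp add: dist_commute)
      qed
      have "emeasure \<mu> (ball q r) \<le> emeasure \<mu> (ball x e)"
        using sub borel by (intro emeasure_mono) auto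
      then have "(q, r) \<in> N"
        using q(1) r(1) e(2) by (simp add: N_def)
      with elim(2) r(2) show False by force
    qed
  qed
qed

section \<open>Independent samples hit every set of positive measure\<close>

text \<open>
  The first \<open>n\<close> variables all miss \<open>B\<close> with probability \<open>(1 - p)\<^sup>n\<close>, where \<open>p > 0\<close> is the
  common probability of hitting \<open>B\<close>.
\<close>

lemma (in prob_space) indep_vars_AE_hits:
  fixes X :: "nat \<Rightarrow> 'a \<Rightarrow> 'b"
  assumes indep: "indep_vars (\<lambda>_. S) X {1..}"
    and distr: "\<And>i. 1 \<le> i \<Longrightarrow> distr M S (X i) = \<mu>"
    and B: "B \<in> sets S" "emeasure \<mu> B > 0"
  shows "AE \<omega> in M. \<exists>i\<ge>1. X i \<omega> \<in> B"
proof -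
  have rv: "X i \<in> measurable M S" if "1 \<le> i" for i
    using indep that by (auto simp: indep_vars_def)
  define p where "p = measure \<mu> B"
  have hit: "prob (X i -` B \<inter> space M) = p" if "1 \<le> i" for i
    using measure_distr[OF rv[OF that] B(1)] distr[OF that] by (simp add: p_def)
  have "prob_space \<mu>"
    using prob_space_distr[OF rv[of 1]] distr[of 1] by simp
  then interpret \<mu>: prob_space \<mu> .
  have p: "0 < p" "p \<le> 1"
    using B(2) by (auto simp: p_def \<mu>.emeasure_eq_measure)
  define A where "A i = X i -` (space S - B) \<inter> space M" for i
  have A: "A i \<in> events" if "1 \<le> i" for i
    using rv[OF that] B(1) by (auto simp: A_def)
  have miss: "prob (A i) = 1 - p" if "1 \<le> i" for i
  proof -
    have "A i = space M - (X i -` B \<inter> space M)"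
      using rv[OF that] by (auto simp: A_def dest: measurable_space)
    then show ?thesis
      using prob_compl[of "X i -` B \<inter> space M"] rv[OF that] B(1) hit[OF that] by auto
  qed
  define F where "F = (\<Inter>i\<in>{1..}. A i)"
  have F: "F \<in> events"
    unfolding F_def by (rule sets.countable_INT') (use A in auto)
  have le: "prob F \<le> (1 - p) ^ Suc n" for n
  proof -
    have "prob F \<le> prob (\<Inter>i\<in>{1..Suc n}. A i)"
      by (rule finite_measure_mono) (use A in \<open>auto simp: F_def\<close>)
    also have "\<dots> = (\<Prod>i\<in>{1..Suc n}. prob (A i))"
      unfolding A_def using indep by (rule indep_varsD) (use B(1) in auto)
    also have "\<dots> = (1 - p) ^ Suc n"
      using miss by simp
    finally show ?thesis .
  qed
  have "(\<lambda>n. (1 - p) ^ Suc n) \<longlonglongrightarrow> 0"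
    using p by (intro LIMSEQ_Suc LIMSEQ_realpow_zero) auto
  then have "prob F \<le> 0"
    by (rule LIMSEQ_le_const) (use le in auto)
  then have "prob F = 0"
    using measure_nonneg[of M F] by simp
  then have "AE \<omega> in M. \<omega> \<notin> F"
    using F by (intro AE_not_in null_setsI) (auto simp: emeasure_eq_measure)
  then show ?thesis
    using AE_space
  proof eventually_elim
    case (elim \<omega>)
    then obtain i where i: "1 \<le> i" "\<omega> \<notin> A i"
      by (auto simp: F_def)
    then have "X i \<omega> \<in> B"
      using elim(2) measurable_space[OF rv[OF i(1)], of \<omega>] by (auto simp: A_def)
    with i(1) show ?case by blast
  qed
qed

section \<open>Hausdorff distance to a dense subset\<close>

lemma hausdorff_dist_le_of_subset:
  assumes "P \<subseteq> C" "0 \<le> r" "\<And>x. x \<in> C \<Longrightarrow> \<exists>y\<in>P. dist x y \<le> r"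
  shows "hausdorff_dist P C \<le> r"
proof -
  have "Inf {t. 0 \<le> t \<and> P \<subseteq> thickening C t} \<le> r"
    using assms(1,2)
    by (intro cInf_lower bdd_belowI[of _ 0]) (auto simp: thickening_def)
  moreover have "Inf {t. 0 \<le> t \<and> C \<subseteq> thickening P t} \<le> r"
    using assms(2,3)
    by (intro cInf_lower bdd_belowI[of _ 0]) (auto simp: thickening_def intro: infdist_le2)
  ultimately show ?thesis
    by (simp add: hausdorff_dist_def)
qed

lemma hausdorff_dist_le_of_net:
  assumes "P \<subseteq> C" "C \<subseteq> (\<Union>c\<in>T. ball c r)" "\<And>c. c \<in> T \<Longrightarrow> P \<inter> ball c r \<noteq> {}" "0 \<le> r"
  shows "hausdorff_dist P C \<le> 2 * r"
proof (rule hausdorff_dist_le_of_subset)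
  fix x assume "x \<in> C"
  then obtain c where c: "c \<in> T" "dist c x < r"
    using assms(2) by auto
  then obtain y where y: "y \<in> P" "dist c y < r"
    using assms(3) by fastforce
  have "dist x y \<le> 2 * r"
    using dist_triangle[of x y c] c(2) y(2) by (simp add: dist_commute)
  with y(1) show "\<exists>y\<in>P. dist x y \<le> 2 * r" by blast
qed (use assms in auto)

text \<open>
  Finitely many centres at each scale: each is hit from some index on, hence so are all of them.
\<close>

lemma hausdorff_dist_initial_segments_tendsto_0:
  fixes x :: "nat \<Rightarrow> 'a::metric_space" and r :: "nat \<Rightarrow> real"
  assumes C: "\<And>i. 1 \<le> i \<Longrightarrow> x i \<in> C"
    and T: "\<And>m. finite (T m)" "\<And>m. C \<subseteq> (\<Union>c\<in>T m. ball c (r m))"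
    and hit: "\<And>m c. c \<in> T m \<Longrightarrow> \<exists>i\<ge>1. x i \<in> ball c (r m)"
    and r: "\<And>m. 0 \<le> r m" "r \<longlonglongrightarrow> 0"
    and d: "0 < d"
  shows "\<forall>\<^sub>F n in sequentially. hausdorff_dist (x ` {1..n}) C < d"
proof -
  have "\<forall>\<^sub>F m in sequentially. r m < d / 2"
    using r(2) d by (intro order_tendstoD) auto
  then obtain m where m: "r m < d / 2"
    by (auto simp: eventually_sequentially)
  have "\<forall>\<^sub>F n in sequentially. x ` {1..n} \<inter> ball c (r m) \<noteq> {}" if c: "c \<in> T m" for c
  proof -
    obtain i where i: "1 \<le> i" "x i \<in> ball c (r m)"
      using hit[OF c] by blast
    show ?thesis
      using eventually_ge_at_top[of i]
    proof eventually_elim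
      case (elim n)
      then have "x i \<in> x ` {1..n}"
        using i(1) by simp
      with i(2) show ?case by blast
    qed
  qed
  then have "\<forall>\<^sub>F n in sequentially. \<forall>c\<in>T m. x ` {1..n} \<inter> ball c (r m) \<noteq> {}"
    using T(1) by (simp add: eventually_ball_finite)
  then show ?thesis
  proof eventually_elim
    case (elim n)
    have "hausdorff_dist (x ` {1..n}) C \<le> 2 * r m"
      by (rule hausdorff_dist_le_of_net[where T = "T m"]) (use C T(2) r(1) elim in auto)
    with m show ?case by simp
  qed
qed

section \<open>Convergence of the sampled barcodes\<close>

lemma compact_barcode_map_tendsto:
  fixes \<beta> :: "'a::metric_space set \<Rightarrow> barcode completion"
  assumes \<beta>: "is_compact_barcode_map TYPE('k::field) k \<beta>"
    and C: "C \<in> nonempty_compacts"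
    and P: "\<forall>\<^sub>F n in sequentially. finite (P n) \<and> P n \<noteq> {}"
    and lim: "\<And>d. 0 < d \<Longrightarrow> \<forall>\<^sub>F n in sequentially. hausdorff_dist (P n) C < d"
  shows "(\<lambda>n. to_completion (barcode_of TYPE('k) k (P n))) \<longlonglongrightarrow> \<beta> C"
proof (rule tendstoI)
  fix e :: real assume "0 < e"
  then obtain d where d: "0 < d"
      "\<And>D. D \<in> nonempty_compacts \<Longrightarrow> hausdorff_dist D C < d \<Longrightarrow> dist (\<beta> D) (\<beta> C) < e"
    using \<beta> C unfolding is_compact_barcode_map_def by meson
  show "\<forall>\<^sub>F n in sequentially. dist (to_completion (barcode_of TYPE('k) k (P n))) (\<beta> C) < e"
    using P lim[OF d(1)]
  proof eventually_elim
    case (elim n)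
    then have "P n \<in> nonempty_compacts"
      by (simp add: nonempty_compacts_def finite_imp_compact)
    moreover have "\<beta> (P n) = to_completion (barcode_of TYPE('k) k (P n))"
      using \<beta> elim(1) unfolding is_compact_barcode_map_def by blast
    ultimately show ?case
      using d(2)[of "P n"] elim(2) by simp
  qed
qed

theorem theorem3p1:
  fixes \<Omega> :: "'w measure"
    and S \<mu> :: "'a::metric_space measure"
    and X :: "nat \<Rightarrow> 'w \<Rightarrow> 'a"
    and C :: "'a set"
    and k :: nat
    and \<beta> :: "'a set \<Rightarrow> barcode completion"
  assumes "prob_space \<Omega>"
    and "space S = UNIV" and "sets borel \<subseteq> sets S"
    and "prob_space.indep_vars \<Omega> (\<lambda>_. S) X {1..}"
    and "\<forall>i\<ge>1. distr \<Omega> S (X i) = \<mu>"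
    and "\<exists>Q. countable Q \<and> (AE \<omega> in \<Omega>. X 1 \<omega> \<in> closure Q)"
    and "compact C" and "measure_support \<mu> = C"
    and "is_compact_barcode_map TYPE('k::field) k \<beta>"
  shows "AE \<omega> in \<Omega>. (\<lambda>n. to_completion (barcode_of TYPE('k) k ((\<lambda>i. X i \<omega>) ` {1..n}))) \<longlonglongrightarrow> \<beta> C"
proof -
  interpret prob_space \<Omega> by fact
  have rv: "X i \<in> measurable \<Omega> S" if "1 \<le> i" for i
    using assms(4) that by (auto simp: indep_vars_def)
  have distr: "distr \<Omega> S (X i) = \<mu>" if "1 \<le> i" for i
    using assms(5) that by blast
  have sets_\<mu>: "sets \<mu> = sets S"
    using distr[of 1] by auto
  have closed: "A \<in> sets S" if "closed A" for A
    using assms(3) that by auto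
  have AE_transfer: "(AE x in \<mu>. x \<in> A) \<longleftrightarrow> (AE \<omega> in \<Omega>. X i \<omega> \<in> A)"
    if "1 \<le> i" "closed A" for i A
  proof -
    have "{x \<in> space S. x \<in> A} \<in> sets S"
      using closed[OF that(2)] assms(2) by simp
    from AE_distr_iff[OF rv[OF that(1)] this] show ?thesis
      unfolding distr[OF that(1)] .
  qed

  obtain Q where Q: "countable Q" "AE \<omega> in \<Omega>. X 1 \<omega> \<in> closure Q"
    using assms(6) by blast
  have "AE x in \<mu>. x \<in> closure Q"
    using AE_transfer[of 1 "closure Q"] Q(2) by simp
  then have "AE x in \<mu>. x \<in> C"
    using AE_in_measure_support[of \<mu> Q] assms(3,8) Q(1) sets_\<mu> by simp
  then have "AE \<omega> in \<Omega>. X i \<omega> \<in> C" if "1 \<le> i" for i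
    using AE_transfer[OF that compact_imp_closed[OF assms(7)]] by simp
  then have inC: "AE \<omega> in \<Omega>. \<forall>i\<in>{1..}. X i \<omega> \<in> C"
    by (simp add: AE_ball_countable)
  \<comment> \<open>A probability space has positive mass, so the sample points witness that the support is not empty.\<close>
  have "C \<noteq> {}"
  proof
    assume "C = {}"
    with inC have "AE \<omega> in \<Omega>. False" by auto
    then show False by simp
  qed
  with assms(7) have C: "C \<in> nonempty_compacts"
    by (simp add: nonempty_compacts_def)

  define r :: "nat \<Rightarrow> real" where "r m = inverse (real (Suc m))" for m
  have r: "0 < r m" for m
    by (simp add: r_def)
  have r_lim: "r \<longlonglongrightarrow> 0"
    unfolding r_def by (rule LIMSEQ_inverse_real_of_nat)
  have "\<exists>T. finite T \<and> T \<subseteq> C \<and> C \<subseteq> (\<Union>c\<in>T. ball c (r m))" for m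
  proof -
    obtain T where "T \<subseteq> C" "finite T" "C \<subseteq> (\<Union>c\<in>T. ball c (r m))"
    proof (rule compactE_image[OF assms(7), of C "\<lambda>c. ball c (r m)"])
      show "C \<subseteq> (\<Union>c\<in>C. ball c (r m))" using r[of m] by auto
    qed auto
    then show ?thesis by blast
  qed
  then obtain T where T: "\<And>m. finite (T m)" "\<And>m. T m \<subseteq> C"
      "\<And>m. C \<subseteq> (\<Union>c\<in>T m. ball c (r m))"
    by metis
  have "AE \<omega> in \<Omega>. \<exists>i\<ge>1. X i \<omega> \<in> ball c (r m)" if "c \<in> T m" for m c
  proof (rule indep_vars_AE_hits[OF assms(4) distr])
    show "ball c (r m) \<in> sets S"
      using assms(3) by auto
    show "0 < emeasure \<mu> (ball c (r m))"
      using that T(2)[of m] assms(8) r[of m] by (auto simp: measure_support_def)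
  qed
  then have hit: "AE \<omega> in \<Omega>. \<forall>m. \<forall>c\<in>T m. \<exists>i\<ge>1. X i \<omega> \<in> ball c (r m)"
    using T(1) by (simp add: AE_all_countable AE_ball_countable countable_finite)

  from inC hit show ?thesis
  proof eventually_elim
    case (elim \<omega>)
    show ?case
    proof (rule compact_barcode_map_tendsto[OF assms(9) C])
      \<comment> \<open>Only the sample of size zero is empty.\<close>
      show "\<forall>\<^sub>F n in sequentially. finite ((\<lambda>i. X i \<omega>) ` {1..n}) \<and> (\<lambda>i. X i \<omega>) ` {1..n} \<noteq> {}"
        using eventually_ge_at_top[of 1] by eventually_elim auto
      show "\<forall>\<^sub>F n in sequentially. hausdorff_dist ((\<lambda>i. X i \<omega>) ` {1..n}) C < d" if "0 < d" for d
        by (rule hausdorff_dist_initial_segments_tendsto_0[where T = T and r = r])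
           (use elim T r r_lim that in \<open>auto intro: less_imp_le\<close>)
    qed
  qed
qed

end
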